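(* Let $I=(A,\prec)$ be an instance of the Stable Roommates problem with Incomplete lists (SRI), let $F_I$ be the set of facts describing $I$, and let $P$ be the answer set program given in the context. Then: (1) For each answer set $S$ for $P\cup F_I$, the set of atoms of the form $\mathit{room}(x,y)$ in $S$ encodes a stable matching of $I$; that is, there is a stable matching $M:A\to A$ of $I$ such that for all $x,y\in A$, $\mathit{room}(x,y)\in S$ if and only if $M(x)=y$. (2) Conversely, each stable matching $M:A\to A$ of $I$ corresponds to a single answer set for $P\cup F_I$; that is, there is exactly one answer set $S$ for $P\cup F_I$ such that for all $x,y\in A$, $\mathit{room}(x,y)\in S$ if and only if $M(x)=y$.
   Context: **SRI.** An SRI instance is a pair $I=(A,\prec)$, where $A$ is a finite set (of agents) and $\prec$ is a collection $(\prec_x)_{x\in A}$ in which each $\prec_x$ is a strict total order on a subset $A_x\subseteq A\setminus\{x\}$ (the preference list of $x$). Here $y\prec_x z$ means that $x$ prefers $y$ to $z$. Agent $y$ is acceptable to $x$ if $y\in A_x$; agents $x,y$ are acceptable to each other if $y\in A_x$ and $x\in A_y$. A matching is a function $M:A\to A$ such that for all $x,y\in A$, $M(x)=y$ if and only if $M(y)=x$, and such that whenever $M(x)=y\neq x$, the agents $x,y$ are acceptable to each other. Agent $x$ is single with respect to $M$ if $M(x)=x$. A pair $\{x,y\}\subseteq A$ with $x\neq y$ blocks $M$ if - (B1) $x$ and $y$ are acceptable to each other, - (B2) $x$ is single with respect to $M$, or $y\prec_x M(x)$, and - (B3) $y$ is single with respect to $M$, or $x\prec_y M(y)$. A matching is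 stable if no pair blocks it. **Facts $F_I$.** $F_I$ consists of the following facts: - $\mathit{agent}(x)$ for every $x\in A$; - $\mathit{prefer2}(x,y,z)$ for every $x\in A$ and all $y,z\in A_x$ such that $z$ immediately follows $y$ in the order $\prec_x$ (e.g. the list $b\prec_a c\prec_a d$ gives $\mathit{prefer2}(a,b,c)$ and $\mathit{prefer2}(a,c,d)$); - $\mathit{prefer2}(x,y,x)$ for every $x\in A$ and every $y\in A_x$ (being matched is preferred to being single). **Program $P$.** $P$ consists of all ground instances of the following rules, where the variables $x,y,z,w,x'$ range over $A$, each "$\_$" is a fresh variable ranging over $A$, and $\mathit{not}$ is default negation: 1. $\mathit{prefer}(x,y,z)\leftarrow \mathit{prefer2}(x,y,z)$. 2. $\mathit{prefer}(x,y,z)\leftarrow \mathit{prefer2}(x,y,w),\ \mathit{prefer}(x,w,z)$. 3. $\mathit{accept}(x,y)\leftarrow \mathit{prefer}(x,y,\_)$. 4. $\mathit{accept}(x,y)\leftarrow \mathit{prefer}(x,\_,y)$. 5. $\mathit{accept2}(x,y)\leftarrow \mathit{accept}(x,y),\ \mathit{accept}(y,x)$. 6. $1\{\mathit{room}(x,y):\mathit{agent}(y),\mathit{accept2}(x,y)\}1\leftarrow \mathit{agent}(x)$. 7. $\leftarrow \mathit{room}(x,y),\ \mathit{not}\ \mathit{room}(y,x)$. 8. $\mathit{single}(x)\leftarrow \mathit{room}(x,x)$. 9. $\leftarrow \mathit{block}(x,y)$, for $x\neq y$. 10. $\mathit{block}(x,y)\leftarrow \mathit{accept2}(x,y),\mathit{single}(x),\mathit{single}(y),\mathit{not}\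 \mathit{room}(x,y)$, for $x\ne y$. 11. $\mathit{block}(x,y)\leftarrow \mathit{accept2}(x,y),\mathit{single}(x),\mathit{like}(y,x),\mathit{not}\ \mathit{room}(x,y)$, for $x\ne y$. 12. $\mathit{block}(x,y)\leftarrow \mathit{accept2}(x,y),\mathit{like}(x,y),\mathit{single}(y),\mathit{not}\ \mathit{room}(x,y)$, for $x\ne y$. 13. $\mathit{block}(x,y)\leftarrow \mathit{accept2}(x,y),\mathit{like}(x,y),\mathit{like}(y,x),\mathit{not}\ \mathit{room}(x,y)$, for $x\ne y$. 14. $\mathit{like}(x,y)\leftarrow \mathit{room}(x,x'),\ \mathit{prefer}(x,y,x')$, for $x'\neq y$. **Semantics.** Answer sets (stable models) are in the usual Gelfond–Lifschitz sense. Rules with empty head are constraints: an answer set may not satisfy their body. The choice rule 6 has the usual meaning: for every $x$ with $\mathit{agent}(x)$ true, the atoms $\mathit{room}(x,y)$ with $\mathit{agent}(y)$ and $\mathit{accept2}(x,y)$ true may be freely chosen to be true or false, subject to the requirement that exactly one of them (lower bound 1, upper bound 1) is true. Equivalently, a set $S$ of ground atoms is an answer set iff (i) $S$ satisfies all constraints and the cardinality bounds of rule 6, and (ii) $S$ is the least model of the positive program obtained by the following steps: dropping constraints; deleting every rule having some $\mathit{not}\ B$ in its body with $B\in S$; deleting the remaining negated atoms from bodies; and replacing rule 6 by the rules $\mathit{room}(x,y)\leftarrow \mathit{agent}(x),\mathit{agent}(y),\mathit{accept2}(x,y)$ for those $x,y$ with $\mathit{room}(x,y)\in S$.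
   Formalization: Part (2) is proved assuming every agent's preference list is nonempty; otherwise it fails: for A={a} with empty list the identity is a stable matching, but accept2(a,a) is underivable, so rule 6 cannot be satisfied and no answer set exists. *)

theory Defs
  imports Main "HOL-Library.FuncSet"
begin

section \<open>Stable roommates with incomplete lists\<close>

text \<open>
  The set \<open>acc I x\<close> of agents on the preference list of \<open>x\<close> is a separate component, since a strict
  order on a one-element set does not determine that set.  A pair \<open>(y, z) \<in> pref I x\<close> means
  that \<open>x\<close> prefers \<open>y\<close> to \<open>z\<close>.
\<close>

record 'a sri =
  agents :: "'a set"
  acc :: "'a \<Rightarrow> 'a set"
  pref :: "'a \<Rightarrow> 'a rel"

definition sri_instance :: "'a sri \<Rightarrow> bool" where
  "sri_instance I \<longleftrightarrow> finite (agents I) \<and>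
     (\<forall>x\<in>agents I. acc I x \<subseteq> agents I - {x} \<and>
        pref I x \<subseteq> acc I x \<times> acc I x \<and> strict_linear_order_on (acc I x) (pref I x))"

definition mutually_acceptable :: "'a sri \<Rightarrow> 'a \<Rightarrow> 'a \<Rightarrow> bool" where
  "mutually_acceptable I x y \<longleftrightarrow> y \<in> acc I x \<and> x \<in> acc I y"

definition matching :: "'a sri \<Rightarrow> ('a \<Rightarrow> 'a) \<Rightarrow> bool" where
  "matching I M \<longleftrightarrow> M \<in> agents I \<rightarrow> agents I \<and>
     (\<forall>x\<in>agents I. \<forall>y\<in>agents I. M x = y \<longleftrightarrow> M y = x) \<and>
     (\<forall>x\<in>agents I. \<forall>y\<in>agents I. M x = y \<and> y \<noteq> x \<longrightarrow> mutually_acceptable I x y)"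

definition single :: "('a \<Rightarrow> 'a) \<Rightarrow> 'a \<Rightarrow> bool" where
  "single M x \<longleftrightarrow> M x = x"

definition blocks :: "'a sri \<Rightarrow> ('a \<Rightarrow> 'a) \<Rightarrow> 'a \<Rightarrow> 'a \<Rightarrow> bool" where
  "blocks I M x y \<longleftrightarrow> x \<noteq> y \<and> mutually_acceptable I x y \<and>
     (single M x \<or> (y, M x) \<in> pref I x) \<and>
     (single M y \<or> (x, M y) \<in> pref I y)"

definition stable_matching :: "'a sri \<Rightarrow> ('a \<Rightarrow> 'a) \<Rightarrow> bool" where
  "stable_matching I M \<longleftrightarrow> matching I M \<and>
     \<not> (\<exists>x\<in>agents I. \<exists>y\<in>agents I. blocks I M x y)"


section \<open>Ground answer set programs\<close>

text \<open>
  \<open>Rule h P N\<close> is the rule with head \<open>h\<close>, positive body \<open>P\<close> and default-negated body \<open>N\<close>;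
  \<open>Constraint P N\<close> is the rule with empty head.
  \<open>Choice l E u P N\<close> is a choice rule with bounds \<open>l\<close> and \<open>u\<close>; a pair \<open>(h, C) \<in> E\<close> stands
  for the conditional atom \<open>h : C\<close>, where \<open>C\<close> is the set of conditions.
\<close>

datatype 'p asp_rule =
    Rule 'p "'p set" "'p set"
  | Constraint "'p set" "'p set"
  | Choice nat "('p \<times> 'p set) set" nat "'p set" "'p set"

text \<open>A positive program is a set of pairs of a head and a body.\<close>

definition is_model :: "('p \<times> 'p set) set \<Rightarrow> 'p set \<Rightarrow> bool" where
  "is_model Q S \<longleftrightarrow> (\<forall>(h, B)\<in>Q. B \<subseteq> S \<longrightarrow> h \<in> S)"

definition is_least_model :: "('p \<times> 'p set) set \<Rightarrow> 'p set \<Rightarrow> bool" where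
  "is_least_model Q S \<longleftrightarrow> is_model Q S \<and> (\<forall>T. is_model Q T \<longrightarrow> S \<subseteq> T)"

fun reduct_rule :: "'p set \<Rightarrow> 'p asp_rule \<Rightarrow> ('p \<times> 'p set) set" where
  "reduct_rule S (Rule h P N) = (if N \<inter> S = {} then {(h, P)} else {})"
| "reduct_rule S (Constraint P N) = {}"
| "reduct_rule S (Choice l E u P N) =
     (if N \<inter> S = {} then {(h, P \<union> C) | h C. (h, C) \<in> E \<and> h \<in> S} else {})"

definition reduct :: "'p asp_rule set \<Rightarrow> 'p set \<Rightarrow> ('p \<times> 'p set) set" where
  "reduct Pr S = (\<Union>r\<in>Pr. reduct_rule S r)"

definition body_holds :: "'p set \<Rightarrow> 'p set \<Rightarrow> 'p set \<Rightarrow> bool" where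
  "body_holds S P N \<longleftrightarrow> P \<subseteq> S \<and> N \<inter> S = {}"

text \<open>The finiteness condition is there because \<^term>\<open>card\<close> is \<open>0\<close> on infinite sets.\<close>

fun satisfies :: "'p set \<Rightarrow> 'p asp_rule \<Rightarrow> bool" where
  "satisfies S (Rule h P N) \<longleftrightarrow> True"
| "satisfies S (Constraint P N) \<longleftrightarrow> \<not> body_holds S P N"
| "satisfies S (Choice l E u P N) \<longleftrightarrow> (body_holds S P N \<longrightarrow>
     (let H = {h \<in> S. \<exists>C. (h, C) \<in> E \<and> C \<subseteq> S} in finite H \<and> l \<le> card H \<and> card H \<le> u))"

definition answer_set :: "'p asp_rule set \<Rightarrow> 'p set \<Rightarrow> bool" where
  "answer_set Pr S \<longleftrightarrow> (\<forall>r\<in>Pr. satisfies S r) \<and> is_least_model (reduct Pr S) S"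


section \<open>The program for stable roommates\<close>

datatype 'a atom =
    Agent 'a
  | Prefer2 'a 'a 'a
  | Prefer 'a 'a 'a
  | Accept 'a 'a
  | Accept2 'a 'a
  | Room 'a 'a
  | Single 'a
  | Block 'a 'a
  | Like 'a 'a

definition sri_atoms :: "'a sri \<Rightarrow> 'a atom set" where
  "sri_atoms I =
     {Agent x | x. x \<in> agents I}
   \<union> {Prefer2 x y z | x y z. x \<in> agents I \<and> (y, z) \<in> pref I x \<and>
        \<not> (\<exists>w. (y, w) \<in> pref I x \<and> (w, z) \<in> pref I x)}
   \<union> {Prefer2 x y x | x y. x \<in> agents I \<and> y \<in> acc I x}"

definition sri_facts :: "'a sri \<Rightarrow> 'a atom asp_rule set" where
  "sri_facts I = {Rule f {} {} | f. f \<in> sri_atoms I}"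

text \<open>Inequalities in rules are evaluated when grounding.\<close>

definition sri_program :: "'a set \<Rightarrow> 'a atom asp_rule set" where
  "sri_program A =
     {Rule (Prefer x y z) {Prefer2 x y z} {} | x y z. x \<in> A \<and> y \<in> A \<and> z \<in> A}
   \<union> {Rule (Prefer x y z) {Prefer2 x y w, Prefer x w z} {} | x y z w.
        x \<in> A \<and> y \<in> A \<and> z \<in> A \<and> w \<in> A}
   \<union> {Rule (Accept x y) {Prefer x y v} {} | x y v. x \<in> A \<and> y \<in> A \<and> v \<in> A}
   \<union> {Rule (Accept x y) {Prefer x v y} {} | x y v. x \<in> A \<and> y \<in> A \<and> v \<in> A}
   \<union> {Rule (Accept2 x y) {Accept x y, Accept y x} {} | x y. x \<in> A \<and> y \<in> A}
   \<union> {Choice 1 {(Room x y, {Agent y, Accept2 x y}) | y. y \<in> A} 1 {Agent x} {} | x. x \<in> A}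
   \<union> {Constraint {Room x y} {Room y x} | x y. x \<in> A \<and> y \<in> A}
   \<union> {Rule (Single x) {Room x x} {} | x. x \<in> A}
   \<union> {Constraint {Block x y} {} | x y. x \<in> A \<and> y \<in> A \<and> x \<noteq> y}
   \<union> {Rule (Block x y) {Accept2 x y, Single x, Single y} {Room x y} | x y.
        x \<in> A \<and> y \<in> A \<and> x \<noteq> y}
   \<union> {Rule (Block x y) {Accept2 x y, Single x, Like y x} {Room x y} | x y.
        x \<in> A \<and> y \<in> A \<and> x \<noteq> y}
   \<union> {Rule (Block x y) {Accept2 x y, Like x y, Single y} {Room x y} | x y.
        x \<in> A \<and> y \<in> A \<and> x \<noteq> y}
   \<union> {Rule (Block x y) {Accept2 x y, Like x y, Like y x} {Room x y} | x y.
        x \<in> A \<and> y \<in> A \<and> x \<noteq> y}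
   \<union> {Rule (Like x y) {Room x x', Prefer x y x'} {} | x y x'.
        x \<in> A \<and> y \<in> A \<and> x' \<in> A \<and> x' \<noteq> y}"

end

(* Prefer is the transitive closure of the covering relation of each preference list,
   extended by the agent itself as last choice; on a finite list this closure is the whole
   order.  Negation and choice act on Room atoms only, so the reduct depends on S only through
   the Room atoms of S, and its least model can be written down explicitly.  Hence an answer set
   is determined by its Room atoms, and the bounds and constraints say that they form a
   stable matching. *)
theory Submission
  imports Defs
begin

section \<open>Covering relation of a finite strict order\<close>

definition covers :: "'a rel \<Rightarrow> 'a rel" where
  "covers r = {(y, z) \<in> r. \<not> (\<exists>w. (y, w) \<in> r \<and> (w, z) \<in> r)}"

text \<open>Induction on the number of elements strictly between \<open>y\<close> and
  \<open>z\<close>. An intermediate \<open>w\<close> splits this interval into two; by transitivity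
  both parts lie inside it, and by irreflexivity both miss \<open>w\<close>, so they are strictly
  smaller.\<close>

lemma subset_trancl_covers:
  assumes "finite r" "trans r" "irrefl r"
  shows "r \<subseteq> (covers r)\<^sup>+"
proof -
  have "(y, z) \<in> r \<Longrightarrow> (y, z) \<in> (covers r)\<^sup>+" for y z
  proof (induction "card {w. (y, w) \<in> r \<and> (w, z) \<in> r}" arbitrary: y z rule: less_induct)
    case less
    show ?case
    proof (cases "\<exists>w. (y, w) \<in> r \<and> (w, z) \<in> r")
      case True
      then obtain w where w: "(y, w) \<in> r" "(w, z) \<in> r" by blast
      have fin: "finite {v. (y, v) \<in> r \<and> (v, z) \<in> r}"
        by (rule finite_subset[OF _ finite_imageI[OF \<open>finite r\<close>, of snd]]) force
      have "{v. (y, v) \<in> r \<and> (v, w) \<in> r} \<subset> {v. (y, v) \<in> r \<and> (v, z) \<in> r}"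
        "{v. (w, v) \<in> r \<and> (v, z) \<in> r} \<subset> {v. (y, v) \<in> r \<and> (v, z) \<in> r}"
        using w \<open>trans r\<close> \<open>irrefl r\<close> unfolding irrefl_def by (blast dest: transD)+
      then have "(y, w) \<in> (covers r)\<^sup>+" "(w, z) \<in> (covers r)\<^sup>+"
        using less.hyps w psubset_card_mono[OF fin] by blast+
      then show ?thesis by (rule trancl_trans)
    next
      case False
      with less.prems show ?thesis by (auto simp: covers_def)
    qed
  qed
  then show ?thesis by auto
qed


section \<open>The least model of the reduct\<close>

text \<open>Closed form of \<open>Accept2\<close>. The diagonal case arises because every
  \<open>y\<close> on the list of \<open>x\<close> gives the fact \<open>Prefer2 x y x\<close>, from
  which \<open>Accept x x\<close> follows.\<close>

definition acceptable2 :: "'a sri \<Rightarrow> 'a \<Rightarrow> 'a \<Rightarrow> bool" where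
  "acceptable2 I x y \<longleftrightarrow> mutually_acceptable I x y \<or> x = y \<and> acc I x \<noteq> {}"

definition prefers :: "'a sri \<Rightarrow> 'a \<Rightarrow> 'a \<Rightarrow> 'a \<Rightarrow> bool" where
  "prefers I x y z \<longleftrightarrow> (y, z) \<in> pref I x \<or> y \<in> acc I x \<and> z = x"

text \<open>\<open>R\<close> is the guess made by the choice rule. The reduct keeps the conditions
  of that rule in its bodies, so only the pairs of \<open>R\<close> meeting them become
  derivable.\<close>

definition rooms :: "'a sri \<Rightarrow> 'a rel \<Rightarrow> 'a rel" where
  "rooms I R = {(x, y) \<in> R. x \<in> agents I \<and> y \<in> agents I \<and> acceptable2 I x y}"

definition likes :: "'a sri \<Rightarrow> 'a rel \<Rightarrow> 'a \<Rightarrow> 'a \<Rightarrow> bool" where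
  "likes I R x y \<longleftrightarrow> (\<exists>x'. (x, x') \<in> rooms I R \<and> prefers I x y x' \<and> x' \<noteq> y)"

text \<open>Explicit least model of the reduct for the guess \<open>R\<close>. The clause for
  \<open>Block\<close> merges the four block rules into a conjunction of two disjunctions; testing
  \<open>rooms I R\<close> instead of \<open>R\<close> for the negated atom makes no difference,
  since the other conjuncts supply the conditions by which \<open>rooms\<close> filters
  \<open>R\<close>.\<close>

primrec holds :: "'a sri \<Rightarrow> 'a rel \<Rightarrow> 'a atom \<Rightarrow> bool" where
  "holds I R (Agent x) \<longleftrightarrow> x \<in> agents I"
| "holds I R (Prefer2 x y z) \<longleftrightarrow> x \<in> agents I \<and> ((y, z) \<in> covers (pref I x) \<or> y \<in> acc I x \<and> z = x)"
| "holds I R (Prefer x y z) \<longleftrightarrow> x \<in> agents I \<and> prefers I x y z"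
| "holds I R (Accept x y) \<longleftrightarrow> x \<in> agents I \<and> (y \<in> acc I x \<or> x = y \<and> acc I x \<noteq> {})"
| "holds I R (Accept2 x y) \<longleftrightarrow> x \<in> agents I \<and> y \<in> agents I \<and> acceptable2 I x y"
| "holds I R (Room x y) \<longleftrightarrow> (x, y) \<in> rooms I R"
| "holds I R (Single x) \<longleftrightarrow> (x, x) \<in> rooms I R"
| "holds I R (Block x y) \<longleftrightarrow> x \<in> agents I \<and> y \<in> agents I \<and> x \<noteq> y \<and> acceptable2 I x y \<and>
     ((x, x) \<in> rooms I R \<or> likes I R x y) \<and> ((y, y) \<in> rooms I R \<or> likes I R y x) \<and>
     (x, y) \<notin> rooms I R"
| "holds I R (Like x y) \<longleftrightarrow> likes I R x y"

abbreviation room_rel :: "'a atom set \<Rightarrow> 'a rel" where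
  "room_rel S \<equiv> {(x, y). Room x y \<in> S}"

abbreviation sri_asp :: "'a sri \<Rightarrow> 'a atom asp_rule set" where
  "sri_asp I \<equiv> sri_program (agents I) \<union> sri_facts I"

section \<open>Reduct and satisfaction, rule by rule\<close>

lemma is_model_reduct:
  "is_model (reduct Pr S) T \<longleftrightarrow> (\<forall>r\<in>Pr. is_model (reduct_rule S r) T)"
  by (auto simp: is_model_def reduct_def)

declare reduct_rule.simps [simp del]

lemma is_model_reduct_Rule [simp]:
  "is_model (reduct_rule S (Rule h P N)) T \<longleftrightarrow> (N \<inter> S = {} \<longrightarrow> P \<subseteq> T \<longrightarrow> h \<in> T)"
  by (auto simp: is_model_def reduct_rule.simps)

lemma is_model_reduct_Constraint [simp]: "is_model (reduct_rule S (Constraint P N)) T"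
  by (auto simp: is_model_def reduct_rule.simps)

lemma is_model_reduct_Choice [simp]:
  "is_model (reduct_rule S (Choice l E u P N)) T \<longleftrightarrow>
     (N \<inter> S = {} \<longrightarrow> (\<forall>(h, C)\<in>E. h \<in> S \<longrightarrow> P \<subseteq> T \<longrightarrow> C \<subseteq> T \<longrightarrow> h \<in> T))"
  by (simp add: is_model_def reduct_rule.simps) blast

lemma satisfies_sri_program:
  "(\<forall>r\<in>sri_program A. satisfies S r) \<longleftrightarrow>
     (\<forall>x\<in>A. satisfies S (Choice 1 {(Room x y, {Agent y, Accept2 x y}) | y. y \<in> A} 1 {Agent x} {})) \<and>
     (\<forall>x\<in>A. \<forall>y\<in>A. Room x y \<in> S \<longrightarrow> Room y x \<in> S) \<and>
     (\<forall>x\<in>A. \<forall>y\<in>A. x \<noteq> y \<longrightarrow> Block x y \<notin> S)"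
proof -
  \<comment> \<open>Each schema of ground rules is a set comprehension over one to four agents;
    \<open>b1\<close> to \<open>b4\<close> turn quantification over such a set into quantification
    over its parameters.\<close>
  have b1: "(\<forall>r\<in>{f x | x. P x}. Q r) \<longleftrightarrow> (\<forall>x. P x \<longrightarrow> Q (f x))"
    for f :: "'a \<Rightarrow> 'a atom asp_rule" and P Q
    by blast
  have b2: "(\<forall>r\<in>{f x y | x y. P x y}. Q r) \<longleftrightarrow> (\<forall>x y. P x y \<longrightarrow> Q (f x y))"
    for f :: "'a \<Rightarrow> 'a \<Rightarrow> 'a atom asp_rule" and P Q
    by blast
  have b3: "(\<forall>r\<in>{f x y z | x y z. P x y z}. Q r) \<longleftrightarrow> (\<forall>x y z. P x y z \<longrightarrow> Q (f x y z))"
    for f :: "'a \<Rightarrow> 'a \<Rightarrow> 'a \<Rightarrow> 'a atom asp_rule" and P Q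
    by blast
  have b4: "(\<forall>r\<in>{f x y z w | x y z w. P x y z w}. Q r) \<longleftrightarrow>
      (\<forall>x y z w. P x y z w \<longrightarrow> Q (f x y z w))"
    for f :: "'a \<Rightarrow> 'a \<Rightarrow> 'a \<Rightarrow> 'a \<Rightarrow> 'a atom asp_rule" and P Q
    by blast
  show ?thesis
    unfolding sri_program_def ball_Un b1 b2 b3 b4 satisfies.simps(1,2) body_holds_def
    by (simp del: satisfies.simps add: Ball_def imp_conjL conj_assoc)
qed

section \<open>Order-theoretic consequences of the instance axioms\<close>

context
  fixes I :: "'a sri"
  assumes inst: "sri_instance I"
begin

lemma finite_agents: "finite (agents I)"
  and acc_subset: "x \<in> agents I \<Longrightarrow> acc I x \<subseteq> agents I - {x}"
  and pref_subset: "x \<in> agents I \<Longrightarrow> pref I x \<subseteq> acc I x \<times> acc I x"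
  and trans_pref: "x \<in> agents I \<Longrightarrow> trans (pref I x)"
  and irrefl_pref: "x \<in> agents I \<Longrightarrow> irrefl (pref I x)"
  using inst unfolding sri_instance_def strict_linear_order_on_def by simp_all

lemma pref_subset_trancl_covers:
  assumes "x \<in> agents I"
  shows "pref I x \<subseteq> (covers (pref I x))\<^sup>+"
proof (rule subset_trancl_covers)
  have "finite (acc I x)"
    using acc_subset[OF assms] finite_agents by (meson finite_Diff finite_subset)
  then show "finite (pref I x)"
    using pref_subset[OF assms] by (meson finite_SigmaI finite_subset)
qed (use assms trans_pref irrefl_pref in auto)

lemma not_pref_self: "x \<in> agents I \<Longrightarrow> (y, y) \<notin> pref I x"
  using irrefl_pref by (auto simp: irrefl_def)

lemma pref_agents:
  assumes "x \<in> agents I" "(y, z) \<in> pref I x"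
  shows "y \<in> agents I" "z \<in> agents I" "y \<noteq> x" "z \<noteq> x" "y \<in> acc I x" "z \<in> acc I x"
  using assms pref_subset[OF assms(1)] acc_subset[OF assms(1)] by auto

lemma sri_atoms_holds: "a \<in> sri_atoms I \<Longrightarrow> holds I R a"
  by (auto simp: sri_atoms_def covers_def)

lemma prefers_agents:
  assumes "x \<in> agents I" "prefers I x y z"
  shows "y \<in> agents I" "z \<in> agents I" "y \<in> acc I x" "z \<in> acc I x \<or> z = x"
  using assms pref_agents[OF assms(1)] acc_subset[OF assms(1)]
  by (auto simp: prefers_def)

lemma is_model_holds: "is_model (reduct (sri_asp I) S) {a. holds I (room_rel S) a}"
proof -
  have prefer1: "prefers I x y z" if "(y, z) \<in> covers (pref I x) \<or> y \<in> acc I x \<and> z = x" for x y z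
    using that by (auto simp: prefers_def covers_def)
  \<comment> \<open>The case \<open>w = x\<close> cannot occur: \<open>prefers I x x z\<close> would
    put \<open>x\<close> on its own list.\<close>
  have prefer2: "prefers I x y z"
    if "x \<in> agents I" "(y, w) \<in> covers (pref I x) \<or> y \<in> acc I x \<and> w = x" "prefers I x w z" for x y z w
    using that pref_agents[OF that(1)] acc_subset[OF that(1)] transD[OF trans_pref[OF that(1)]]
    unfolding prefers_def covers_def by blast
  have accept: "acceptable2 I x y"
    if "y \<in> acc I x \<or> x = y \<and> acc I x \<noteq> {}" "x \<in> acc I y \<or> y = x \<and> acc I y \<noteq> {}" for x y
    using that by (auto simp: acceptable2_def mutually_acceptable_def)
  have room: "(x, y) \<in> rooms I (room_rel S) \<longleftrightarrow>
      Room x y \<in> S \<and> x \<in> agents I \<and> y \<in> agents I \<and> acceptable2 I x y" for x y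
    by (auto simp: rooms_def)
  have like: "likes I (room_rel S) x y"
    if "(x, x') \<in> rooms I (room_rel S)" "prefers I x y x'" "x' \<noteq> y" for x y x'
    using that by (auto simp: likes_def)
  have choice: "is_model (reduct_rule S (Choice 1 {(Room x y, {Agent y, Accept2 x y}) | y. y \<in> agents I}
      1 {Agent x} {})) {a. holds I (room_rel S) a}" for x
    by (fastforce simp: room)
  show ?thesis
    unfolding is_model_reduct
    apply (rule ballI)
    apply (unfold sri_program_def sri_facts_def)
    \<comment> \<open>One goal per rule schema, plus one for the facts. The simplification below
      settles the choice rule, both constraints and the rule for \<open>Single\<close>; the other
      goals remain in program order.\<close>
    apply (elim UnE CollectE exE conjE; hypsubst)
                  apply (unfold is_model_reduct_Rule)
                  apply (simp_all only: choice is_model_reduct_Constraint insert_subset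
                    mem_Collect_eq holds.simps empty_subsetI simp_thms Int_insert_left Int_empty_left)
              apply (blast intro: prefer1)
             apply (blast intro: prefer2)
            apply (blast dest: prefers_agents(3))
           apply (blast dest: prefers_agents(3,4))
          apply (blast intro: accept)
         apply (simp add: room)
        apply (simp add: room)
       apply (simp add: room)
      apply (simp add: room)
     apply (blast intro: like)
    apply (blast intro: sri_atoms_holds)
    done
qed

text \<open>Every atom of the explicit model has a derivation. The rules are first restated as
  closure properties of \<open>T\<close>; the primed facts then follow the dependency order, from
  the facts through \<open>Prefer\<close>, \<open>Accept\<close>, \<open>Accept2\<close> and
  \<open>Room\<close> to \<open>Single\<close>, \<open>Like\<close> and
  \<open>Block\<close>.\<close>

lemma holds_in_model:
  assumes T: "is_model (reduct (sri_asp I) S) T" and h: "holds I (room_rel S) a"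
  shows "a \<in> T"
proof -
  have rule: "h \<in> T" if "Rule h P N \<in> sri_asp I" "P \<subseteq> T" "N \<inter> S = {}" for h P N
    using bspec[OF T[unfolded is_model_reduct] that(1)] that(2,3) by simp
  have choice: "h \<in> T"
    if "Choice l E u P N \<in> sri_asp I" "(h, C) \<in> E" "h \<in> S" "P \<subseteq> T" "C \<subseteq> T" "N \<inter> S = {}" for h l E u P N C
    using bspec[OF T[unfolded is_model_reduct] that(1)] that(2-) by auto
  have facts: "a \<in> T" if "a \<in> sri_atoms I" for a
    by (rule rule[of a "{}" "{}"]) (use that in \<open>simp_all add: sri_facts_def\<close>)
  have prefer1: "Prefer x y z \<in> T"
    if "Prefer2 x y z \<in> T" "x \<in> agents I" "y \<in> agents I" "z \<in> agents I" for x y z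
    by (rule rule[of _ "{Prefer2 x y z}" "{}"]) (use that in \<open>simp_all add: sri_program_def\<close>)
  have prefer2: "Prefer x y z \<in> T"
    if "Prefer2 x y w \<in> T" "Prefer x w z \<in> T"
      "x \<in> agents I" "y \<in> agents I" "z \<in> agents I" "w \<in> agents I" for x y z w
    by (rule rule[of _ "{Prefer2 x y w, Prefer x w z}" "{}"])
      (use that in \<open>auto simp: sri_program_def\<close>)
  have accept1: "Accept x y \<in> T"
    if "Prefer x y z \<in> T" "x \<in> agents I" "y \<in> agents I" "z \<in> agents I" for x y z
    by (rule rule[of _ "{Prefer x y z}" "{}"])
      (use that in \<open>auto simp: sri_program_def\<close>)
  have accept2: "Accept x z \<in> T"
    if "Prefer x y z \<in> T" "x \<in> agents I" "y \<in> agents I" "z \<in> agents I" for x y z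
    by (rule rule[of _ "{Prefer x y z}" "{}"])
      (use that in \<open>auto simp: sri_program_def\<close>)
  have acc2: "Accept2 x y \<in> T"
    if "Accept x y \<in> T" "Accept y x \<in> T" "x \<in> agents I" "y \<in> agents I" for x y
    by (rule rule[of _ "{Accept x y, Accept y x}" "{}"])
      (use that in \<open>simp_all add: sri_program_def\<close>)
  have room: "Room x y \<in> T"
    if "Agent x \<in> T" "Agent y \<in> T" "Accept2 x y \<in> T" "Room x y \<in> S"
      "x \<in> agents I" "y \<in> agents I" for x y
    by (rule choice[of 1 "{(Room x y, {Agent y, Accept2 x y}) | y. y \<in> agents I}" 1
          "{Agent x}" "{}" _ "{Agent y, Accept2 x y}"])
      (use that in \<open>auto simp: sri_program_def\<close>)
  have single: "Single x \<in> T" if "Room x x \<in> T" "x \<in> agents I" for x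
    by (rule rule[of _ "{Room x x}" "{}"]) (use that in \<open>simp_all add: sri_program_def\<close>)
  \<comment> \<open>Letting \<open>u\<close> and \<open>v\<close> each be a \<open>Single\<close> or
    a \<open>Like\<close> atom covers all four block rules at once.\<close>
  have block: "Block x y \<in> T"
    if "x \<noteq> y" "Accept2 x y \<in> T" "u \<in> {Single x, Like x y}" "u \<in> T"
      "v \<in> {Single y, Like y x}" "v \<in> T" "Room x y \<notin> S" "x \<in> agents I" "y \<in> agents I" for x y u v
    by (rule rule[of _ "{Accept2 x y, u, v}" "{Room x y}"])
      (use that in \<open>auto simp: sri_program_def\<close>)
  have like: "Like x y \<in> T"
    if "x' \<noteq> y" "Room x x' \<in> T" "Prefer x y x' \<in> T"
      "x \<in> agents I" "y \<in> agents I" "x' \<in> agents I" for x y x'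
    by (rule rule[of _ "{Room x x', Prefer x y x'}" "{}"])
      (use that in \<open>auto simp: sri_program_def\<close>)
  have Agent': "Agent x \<in> T" if "x \<in> agents I" for x
    using facts that by (auto simp: sri_atoms_def)
  have Prefer2': "Prefer2 x y z \<in> T"
    if "x \<in> agents I" "(y, z) \<in> covers (pref I x) \<or> y \<in> acc I x \<and> z = x" for x y z
  proof -
    have "Prefer2 x y z \<in> sri_atoms I" using that by (auto simp: sri_atoms_def covers_def)
    then show ?thesis by (rule facts)
  qed
  have Prefer': "Prefer x y z \<in> T" if x: "x \<in> agents I" and "prefers I x y z" for x y z
  proof (cases "(y, z) \<in> pref I x")
    case True
    then have "(y, z) \<in> (covers (pref I x))\<^sup>+"
      using pref_subset_trancl_covers[OF x] by blast
    then show ?thesis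
    \<comment> \<open>The recursive rule for \<open>Prefer\<close> prepends a \<open>Prefer2\<close>
      step, so the chain of covering pairs is built from its front.\<close>
    proof (induction rule: converse_trancl_induct)
      case (base y)
      then show ?case
        using prefer1 Prefer2'[OF x] x pref_agents[OF x] unfolding covers_def by blast
    next
      case (step y w)
      \<comment> \<open>The rules are ground over agents only. Collapsing the chain from
        \<open>w\<close> to \<open>z\<close> to a pair of \<open>pref I x\<close> shows that its end
        points are agents.\<close>
      have sub: "covers (pref I x) \<subseteq> pref I x" by (auto simp: covers_def)
      have "(y, w) \<in> pref I x" using step(1) sub by blast
      moreover have "(w, z) \<in> pref I x"
        using trancl_mono[OF step(2) sub] by (simp only: trancl_id[OF trans_pref[OF x]])
      moreover have "Prefer2 x y w \<in> T" using Prefer2'[OF x] step(1) by blast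
      ultimately show ?case
        using step(3) x pref_agents[OF x] by (intro prefer2[of x y w z]) auto
    qed
  next
    case False
    then have "z = x" "y \<in> acc I x" using that by (auto simp: prefers_def)
    with x show ?thesis
      using Prefer2'[OF x] prefers_agents[OF that] by (intro prefer1) auto
  qed
  have Accept': "Accept x y \<in> T" if x: "x \<in> agents I" and y: "y \<in> acc I x \<or> x = y \<and> acc I x \<noteq> {}" for x y
  proof -
    \<comment> \<open>For \<open>y = x\<close> any list member \<open>z\<close> serves:
      \<open>Prefer x z x\<close> yields both \<open>Accept x z\<close> and
      \<open>Accept x x\<close>.\<close>
    obtain z where "z \<in> acc I x" "y = z \<or> y = x" using y by blast
    then have "prefers I x z x" "z \<in> agents I" "y = z \<or> y = x"
      using acc_subset[OF x] by (auto simp: prefers_def)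
    with Prefer' x accept1 accept2 show ?thesis by blast
  qed
  have Accept2': "Accept2 x y \<in> T" if "x \<in> agents I" "y \<in> agents I" "acceptable2 I x y" for x y
  proof -
    have "Accept x y \<in> T" "Accept y x \<in> T"
      using that Accept' by (auto simp: acceptable2_def mutually_acceptable_def)
    then show ?thesis using acc2 that by blast
  qed
  have Room': "Room x y \<in> T" if "(x, y) \<in> rooms I (room_rel S)" for x y
    using that room Agent' Accept2' by (auto simp: rooms_def)
  have Single': "Single x \<in> T" if "(x, x) \<in> rooms I (room_rel S)" for x
    using single Room'[OF that] that by (auto simp: rooms_def)
  have Like': "Like x y \<in> T" if lk: "likes I (room_rel S) x y" for x y
  proof -
    obtain x' where x': "(x, x') \<in> rooms I (room_rel S)" "prefers I x y x'" "x' \<noteq> y"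
      using lk by (auto simp: likes_def)
    then have "x \<in> agents I" by (auto simp: rooms_def)
    with x' show ?thesis
      using like Room'[OF x'(1)] Prefer' prefers_agents[of x y x'] by blast
  qed
  show ?thesis
  proof (cases a)
    case (Block x y)
    note h' = h[unfolded Block holds.simps]
    \<comment> \<open>Absence from \<open>rooms\<close> gives absence from \<open>S\<close>, because
      \<open>h'\<close> also provides the agents and their acceptability.\<close>
    then have "Room x y \<notin> S" by (auto simp: rooms_def)
    then show ?thesis
      unfolding Block using h' Accept2' Single' Like' block[of x y] by blast
  next
    case (Agent x)
    show ?thesis unfolding Agent by (rule Agent') (use h Agent in simp_all)
  next
    case (Prefer2 x y z)
    show ?thesis unfolding Prefer2 by (rule Prefer2') (use h Prefer2 in simp_all)
  next
    case (Prefer x y z)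
    show ?thesis unfolding Prefer by (rule Prefer') (use h Prefer in simp_all)
  next
    case (Accept x y)
    show ?thesis unfolding Accept by (rule Accept') (use h Accept in simp_all)
  next
    case (Accept2 x y)
    show ?thesis unfolding Accept2 by (rule Accept2') (use h Accept2 in simp_all)
  next
    case (Room x y)
    show ?thesis unfolding Room by (rule Room') (use h Room in simp_all)
  next
    case (Single x)
    show ?thesis unfolding Single by (rule Single') (use h Single in simp_all)
  next
    case (Like x y)
    show ?thesis unfolding Like by (rule Like') (use h Like in simp_all)
  qed
qed

text \<open>Soundness and derivability together. For \<open>T = S\<close> the condition becomes a
  fixed-point equation for \<open>S\<close> whose right-hand side sees only the \<open>Room\<close>
  atoms of \<open>S\<close>.\<close>

lemma is_least_model_sri_asp:
  "is_least_model (reduct (sri_asp I) S) T \<longleftrightarrow> T = {a. holds I (room_rel S) a}"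
proof -
  have "{a. holds I (room_rel S) a} \<subseteq> U" if "is_model (reduct (sri_asp I) S) U" for U
    using holds_in_model[OF that] by blast
  then show ?thesis
    using is_model_holds[of S] unfolding is_least_model_def by (metis subset_antisym)
qed


section \<open>Answer sets and stable matchings\<close>

lemma Room_agents:
  assumes "S = {a. holds I (room_rel S) a}" "Room x y \<in> S"
  shows "x \<in> agents I" "y \<in> agents I" "acceptable2 I x y"
proof -
  have "holds I (room_rel S) (Room x y)"
    using subsetD[OF equalityD1[OF assms(1)] assms(2)] by (rule CollectD)
  then show "x \<in> agents I" "y \<in> agents I" "acceptable2 I x y" by (auto simp: rooms_def)
qed

text \<open>Under the fixed-point equation every \<open>Room x y\<close> in \<open>S\<close>
  satisfies the conditions of the choice rule, so the bounds count all \<open>Room\<close> atoms of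
  \<open>x\<close>. For the same reason \<open>y\<close> may range over the whole type in the unique
  existence.\<close>

lemma answer_set_iff:
  "answer_set (sri_asp I) S \<longleftrightarrow>
     S = {a. holds I (room_rel S) a} \<and>
     (\<forall>x\<in>agents I. \<exists>!y. Room x y \<in> S) \<and>
     (\<forall>x\<in>agents I. \<forall>y\<in>agents I. Room x y \<in> S \<longrightarrow> Room y x \<in> S) \<and>
     (\<forall>x\<in>agents I. \<forall>y\<in>agents I. x \<noteq> y \<longrightarrow> Block x y \<notin> S)"
proof (cases "S = {a. holds I (room_rel S) a}")
  case True
  have S: "a \<in> S \<longleftrightarrow> holds I (room_rel S) a" for a
    using eqset_imp_iff[OF True, of a] by (simp only: mem_Collect_eq)
  have choice: "satisfies S (Choice 1 {(Room x y, {Agent y, Accept2 x y}) | y. y \<in> agents I} 1 {Agent x} {})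
      \<longleftrightarrow> (\<exists>!y. Room x y \<in> S)" if x: "x \<in> agents I" for x
  proof -
    define H where "H = {h \<in> S. \<exists>C. (h, C) \<in> {(Room x y, {Agent y, Accept2 x y}) | y. y \<in> agents I} \<and> C \<subseteq> S}"
    have H: "H = Room x ` {y. Room x y \<in> S}"
    proof -
      have "y \<in> agents I \<and> Agent y \<in> S \<and> Accept2 x y \<in> S" if "Room x y \<in> S" for y
        using x Room_agents[OF True that] S[of "Agent y"] S[of "Accept2 x y"] by simp
      then show ?thesis unfolding H_def by blast
    qed
    have "card H = card {y. Room x y \<in> S}"
      unfolding H by (rule card_image) (simp add: inj_on_def)
    \<comment> \<open>Cardinality 1 excludes an infinite set, whose \<open>card\<close> is
      0.\<close>
    moreover have "finite H" if "card H = 1" using that by (simp add: card_ge_0_finite)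
    ultimately have "finite H \<and> 1 \<le> card H \<and> card H \<le> 1 \<longleftrightarrow> card {y. Room x y \<in> S} = 1"
      by (metis le_antisym le_refl)
    also have "\<dots> \<longleftrightarrow> (\<exists>!y. Room x y \<in> S)"
      unfolding One_nat_def card_1_singleton_iff set_eq_iff by auto
    finally show ?thesis
      using S[of "Agent x"] x
      by (simp only: satisfies.simps body_holds_def Let_def H_def) simp
  qed
  have choices: "(\<forall>x\<in>agents I. satisfies S
        (Choice 1 {(Room x y, {Agent y, Accept2 x y}) | y. y \<in> agents I} 1 {Agent x} {}))
      \<longleftrightarrow> (\<forall>x\<in>agents I. \<exists>!y. Room x y \<in> S)"
    by (rule ball_cong[OF refl choice])
  have facts: "\<forall>r\<in>sri_facts I. satisfies S r" by (auto simp: sri_facts_def)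
  show ?thesis
    unfolding answer_set_def is_least_model_sri_asp ball_Un satisfies_sri_program choices
    by (intro iffI conjI; (elim conjE)?; (assumption | rule facts))
next
  case False
  then show ?thesis by (simp only: answer_set_def is_least_model_sri_asp simp_thms)
qed

text \<open>If \<open>M u = u\<close>, the first disjunct already holds; otherwise
  \<open>likes\<close> compares \<open>v\<close> with the partner \<open>M u\<close> inside
  \<open>pref I u\<close>. The negated \<open>Room\<close> atom is automatic for a blocking pair:
  \<open>M x = y\<close> would require \<open>x = y\<close> or
  \<open>(y, y) \<in> pref I x\<close>.\<close>

lemma holds_Block_iff_blocks:
  assumes R: "\<And>x y. x \<in> agents I \<Longrightarrow> (x, y) \<in> rooms I R \<longleftrightarrow> M x = y"
    and xy: "x \<in> agents I" "y \<in> agents I"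
  shows "holds I R (Block x y) \<longleftrightarrow> blocks I M x y"
proof -
  have likes: "(u, u) \<in> rooms I R \<or> likes I R u v \<longleftrightarrow> single M u \<or> (v, M u) \<in> pref I u"
    if "u \<in> agents I" for u v
    using that pref_agents[OF that, of v] not_pref_self[OF that] unfolding likes_def R[OF that] single_def prefers_def
    by auto
  show ?thesis
    using xy not_pref_self[OF xy(1)] likes[OF xy(1), of y] likes[OF xy(2), of x] R[OF xy(1)]
    by (auto simp: blocks_def acceptable2_def single_def)
qed

lemma answer_set_stable_matching:
  assumes S: "answer_set (sri_asp I) S"
  shows "\<exists>M. stable_matching I M \<and>
    (\<forall>x\<in>agents I. \<forall>y\<in>agents I. Room x y \<in> S \<longleftrightarrow> M x = y)"
proof -
  have eq: "S = {a. holds I (room_rel S) a}"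
    and ex1: "\<And>x. x \<in> agents I \<Longrightarrow> \<exists>!y. Room x y \<in> S"
    and sym: "\<And>x y. x \<in> agents I \<Longrightarrow> y \<in> agents I \<Longrightarrow> Room x y \<in> S \<Longrightarrow> Room y x \<in> S"
    and nb: "\<And>x y. x \<in> agents I \<Longrightarrow> y \<in> agents I \<Longrightarrow> x \<noteq> y \<Longrightarrow> Block x y \<notin> S"
    using S unfolding answer_set_iff by blast+
  \<comment> \<open>Meaningful for agents only, by \<open>ex1\<close>; values elsewhere do not
    affect stability.\<close>
  define M where "M x = (THE y. Room x y \<in> S)" for x
  have M: "Room x y \<in> S \<longleftrightarrow> M x = y" if "x \<in> agents I" for x y
    using theI_unique[OF ex1[OF that], of y] unfolding M_def by (simp only: eq_commute)
  note R = Room_agents[OF eq]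
  have rooms: "(x, y) \<in> rooms I (room_rel S) \<longleftrightarrow> M x = y" if "x \<in> agents I" for x y
    using that M[OF that, of y] R[of x y] by (auto simp: rooms_def)
  have bl: "holds I (room_rel S) (Block x y) \<longleftrightarrow> blocks I M x y"
    if "x \<in> agents I" "y \<in> agents I" for x y
    by (rule holds_Block_iff_blocks) (fact rooms that)+
  have "matching I M"
    unfolding matching_def
  proof (intro conjI ballI impI)
    show "M \<in> agents I \<rightarrow> agents I" using M R(2) by blast
    show "M x = y \<longleftrightarrow> M y = x" if "x \<in> agents I" "y \<in> agents I" for x y
      using M sym that by blast
    \<comment> \<open>The condition \<open>y \<noteq> x\<close> rules out the diagonal case of
      \<open>acceptable2\<close>.\<close>
    show "mutually_acceptable I x y" if "x \<in> agents I" "y \<in> agents I" "M x = y \<and> y \<noteq> x" for x y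
      using M R(3)[of x y] that by (auto simp: acceptable2_def)
  qed
  moreover have "\<not> blocks I M x y" if xy: "x \<in> agents I" "y \<in> agents I" for x y
  proof
    assume b: "blocks I M x y"
    then have "Block x y \<in> S" using bl[OF xy] b eqset_imp_iff[OF eq, of "Block x y"] by blast
    with nb[OF xy] b show False by (auto simp: blocks_def)
  qed
  ultimately show ?thesis using M by (auto simp: stable_matching_def)
qed

text \<open>
  Nonempty lists are needed because \<^term>\<open>Accept2 x x\<close>, hence \<^term>\<open>Room x x\<close>, is
  underivable for an agent \<open>x\<close> with an empty list.
\<close>

lemma stable_matching_answer_set:
  assumes ne: "\<forall>x\<in>agents I. acc I x \<noteq> {}" and M: "stable_matching I M"
  shows "\<exists>!S. answer_set (sri_asp I) S \<and>
    (\<forall>x\<in>agents I. \<forall>y\<in>agents I. Room x y \<in> S \<longleftrightarrow> M x = y)"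
proof (rule ex1I)
  \<comment> \<open>Restricted to agents because \<open>M\<close> is arbitrary elsewhere, whereas
    \<open>rooms\<close> contains pairs of agents only.\<close>
  let ?R = "{(x, y). x \<in> agents I \<and> M x = y}"
  let ?S = "{a. holds I ?R a}"
  have MA: "M x \<in> agents I" if "x \<in> agents I" for x
    using M that by (auto simp: stable_matching_def matching_def)
  have "acceptable2 I x (M x)" if "x \<in> agents I" for x
    using M that MA[OF that] ne by (auto simp: stable_matching_def matching_def acceptable2_def)
  \<comment> \<open>Filtering leaves \<open>?R\<close> unchanged, so the \<open>Room\<close> atoms
    of \<open>?S\<close> give back \<open>?R\<close> and \<open>?S\<close> solves the fixed-point
    equation.\<close>
  with MA have rooms: "rooms I ?R = ?R" by (auto simp: rooms_def)
  then have rel: "room_rel ?S = ?R" by auto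
  have "\<not> holds I ?R (Block x y)" if "x \<in> agents I" "y \<in> agents I" for x y
    using holds_Block_iff_blocks[of ?R M x y] that M rooms by (auto simp: stable_matching_def)
  moreover have "M y = x" if "x \<in> agents I" "y \<in> agents I" "M x = y" for x y
    using M that by (auto simp: stable_matching_def matching_def)
  ultimately have "answer_set (sri_asp I) ?S"
    unfolding answer_set_iff rel mem_Collect_eq holds.simps(6) rooms prod.case by blast
  then show "answer_set (sri_asp I) ?S \<and> (\<forall>x\<in>agents I. \<forall>y\<in>agents I. Room x y \<in> ?S \<longleftrightarrow> M x = y)"
    by (simp add: rooms)
  fix S
  assume S: "answer_set (sri_asp I) S \<and> (\<forall>x\<in>agents I. \<forall>y\<in>agents I. Room x y \<in> S \<longleftrightarrow> M x = y)"
  then have eq: "S = {a. holds I (room_rel S) a}" unfolding answer_set_iff by blast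
  \<comment> \<open>By \<open>Room_agents\<close> the set \<open>S\<close> has no
    \<open>Room\<close> atoms outside the agents, so agreement with \<open>M\<close> on agents
    determines all its \<open>Room\<close> atoms and hence \<open>S\<close>.\<close>
  have "Room x y \<in> S \<longleftrightarrow> x \<in> agents I \<and> M x = y" for x y
    using conjunct2[OF S] Room_agents(1,2)[OF eq, of x y] MA[of x] by blast
  then have "room_rel S = ?R" by simp
  then show "S = ?S" using eq by (rule subst)
qed

end

theorem theorem1:
  fixes I :: "'a sri"
  assumes "sri_instance I"
  shows "(\<forall>S. answer_set (sri_program (agents I) \<union> sri_facts I) S \<longrightarrow>
            (\<exists>M. stable_matching I M \<and>
                 (\<forall>x\<in>agents I. \<forall>y\<in>agents I. Room x y \<in> S \<longleftrightarrow> M x = y))) \<and>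
         ((\<forall>x\<in>agents I. acc I x \<noteq> {}) \<longrightarrow>
            (\<forall>M. stable_matching I M \<longrightarrow>
              (\<exists>!S. answer_set (sri_program (agents I) \<union> sri_facts I) S \<and>
                 (\<forall>x\<in>agents I. \<forall>y\<in>agents I. Room x y \<in> S \<longleftrightarrow> M x = y))))"
  by (intro conjI allI impI answer_set_stable_matching[OF assms] stable_matching_answer_set[OF assms])

end
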